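(* Let $d$ be a distance on the Heisenberg group $\mathbb{H}$ such that $d\le d_{cc}$ and $\mathcal{H}^4_d(B_{cc}(0,1))>0$. Assume that the left translations in $\mathbb{H}$ are biLipschitz with respect to $d$. Then $d$ and $d_{cc}$ are biLipschitz equivalent on compact sets.
   Context: $\mathbb{H}$ is $\mathbb{R}^3$ with the group law $p\cdot q = (x_p+x_q,\, y_p+y_q,\, z_p+z_q+\tfrac12(x_py_q-y_px_q))$. The Carnot-Carathéodory (subRiemannian) distance $d_{cc}$ is the left-invariant distance for which $d_{cc}(p,q)$ is the infimum of lengths of absolutely continuous curves from $p$ to $q$ that are a.e. tangent to the span of the left-invariant vector fields $X=\partial_x-\frac y2\partial_z$, $Y=\partial_y+\frac x2\partial_z$, the length being computed by declaring $X,Y$ orthonormal. Compact sets are with respect to the usual topology of $\mathbb{R}^3$ (the topology of $d_{cc}$). A distance means a metric on the set. $\mathcal{H}^4_d$ is the Hausdorff $4$-measure with respect to $d$, and $B_{cc}(0,1)$ is the unit ball of $d_{cc}$ about the identity $0=(0,0,0)$. Left translations being biLipschitz with respect to $d$ means: for each $g\in\mathbb{H}$ the map $p\mapsto g\cdot p$ is biLipschitz from $(\mathbb{H},d)$ to itself (with a constant that may depend on $g$). $d$ and $d_{cc}$ are biLipschitz equivalent on a set $K$ if there is $L\ge1$ with $\frac1L d_{cc}(p,q)\le d(p,q)\le L d_{cc}(p,q)$ for all $p,q\in K$; on compact sets, this holds for every compact $K\subset\mathbb{H}$ with $L$ depending on $K$. *)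

theory Defs
  imports "HOL-Analysis.Analysis"
begin

section \<open>The Heisenberg group\<close>

type_synonym heis = "real ^ 3"

definition hmult :: "heis \<Rightarrow> heis \<Rightarrow> heis"  (infixl \<open>\<odot>\<close> 70) where
  "p \<odot> q = vector [p$1 + q$1, p$2 + q$2, p$3 + q$3 + (p$1 * q$2 - p$2 * q$1) / 2]"

definition X_field :: "heis \<Rightarrow> heis" where
  "X_field p = vector [1, 0, - (p$2) / 2]"

definition Y_field :: "heis \<Rightarrow> heis" where
  "Y_field p = vector [0, 1, p$1 / 2]"


section \<open>The Carnot-Caratheodory distance\<close>

text \<open>
  Absolute continuity of a curve on \<open>{a..b}\<close>: the members of a division are non-degenerate or
  one-point compact intervals \<open>K = {Inf K..Sup K}\<close> with pairwise disjoint interiors, and they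
  need not cover \<open>{a..b}\<close>.
\<close>

definition abs_cont_on :: "real \<Rightarrow> real \<Rightarrow> (real \<Rightarrow> 'a::real_normed_vector) \<Rightarrow> bool" where
  "abs_cont_on a b \<gamma> \<longleftrightarrow>
     (\<forall>\<epsilon>>0. \<exists>\<delta>>0. \<forall>\<D> S. \<D> division_of S \<and> S \<subseteq> {a..b} \<and> (\<Sum>K\<in>\<D>. Sup K - Inf K) < \<delta> \<longrightarrow>
        (\<Sum>K\<in>\<D>. norm (\<gamma> (Sup K) - \<gamma> (Inf K))) < \<epsilon>)"

definition horizontal_curve :: "real \<Rightarrow> real \<Rightarrow> (real \<Rightarrow> heis) \<Rightarrow> bool" where
  "horizontal_curve a b \<gamma> \<longleftrightarrow>
     a \<le> b \<and> abs_cont_on a b \<gamma> \<and>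
     (AE t in lebesgue_on {a..b}.
        \<gamma> differentiable (at t) \<and>
        vector_derivative \<gamma> (at t) \<in> span {X_field (\<gamma> t), Y_field (\<gamma> t)})"

text \<open>
  The norm on the horizontal plane at \<open>p\<close> for which \<open>X, Y\<close> are orthonormal. It is meaningful
  only for \<open>v\<close> in the span of \<open>X_field p\<close> and \<open>Y_field p\<close>.
\<close>

definition horizontal_norm :: "heis \<Rightarrow> heis \<Rightarrow> real" where
  "horizontal_norm p v =
     (THE r. \<exists>\<alpha> \<beta>. v = \<alpha> *\<^sub>R X_field p + \<beta> *\<^sub>R Y_field p \<and> r = sqrt (\<alpha>\<^sup>2 + \<beta>\<^sup>2))"

lemma horizontal_norm_eq:
  "horizontal_norm p (\<alpha> *\<^sub>R X_field p + \<beta> *\<^sub>R Y_field p) = sqrt (\<alpha>\<^sup>2 + \<beta>\<^sup>2)"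
proof -
  have "\<alpha>' = \<alpha> \<and> \<beta>' = \<beta>"
    if "\<alpha> *\<^sub>R X_field p + \<beta> *\<^sub>R Y_field p = \<alpha>' *\<^sub>R X_field p + \<beta>' *\<^sub>R Y_field p" for \<alpha>' \<beta>'
    using that by (simp add: vec_eq_iff forall_3 X_field_def Y_field_def vector_3)
  then show ?thesis
    unfolding horizontal_norm_def by (intro the_equality) blast+
qed

definition cc_length :: "real \<Rightarrow> real \<Rightarrow> (real \<Rightarrow> heis) \<Rightarrow> real" where
  "cc_length a b \<gamma> =
     (LINT t|lebesgue_on {a..b}. horizontal_norm (\<gamma> t) (vector_derivative \<gamma> (at t)))"

text \<open>
  The infimum is taken in the reals; the set of lengths is bounded below by \<open>0\<close> and nonempty
  because any two points are joined by a horizontal curve.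
\<close>

definition cc_dist :: "heis \<Rightarrow> heis \<Rightarrow> real" where
  "cc_dist p q =
     Inf {cc_length a b \<gamma> | a b \<gamma>. horizontal_curve a b \<gamma> \<and> \<gamma> a = p \<and> \<gamma> b = q}"

definition cc_ball :: "heis \<Rightarrow> real \<Rightarrow> heis set" where
  "cc_ball p r = {q. cc_dist p q < r}"


section \<open>Hausdorff measure of a distance function\<close>

definition diam_of :: "('a \<Rightarrow> 'a \<Rightarrow> real) \<Rightarrow> 'a set \<Rightarrow> ennreal" where
  "diam_of d E = (SUP p\<in>E. SUP q\<in>E. ennreal (d p q))"

text \<open>
  The \<open>s\<close>-dimensional Hausdorff (outer) measure, without normalising constant. Empty members of
  a cover contribute \<open>0\<close>, also for \<open>s = 0\<close>; they allow finite covers.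
\<close>

definition hausdorff_measure :: "nat \<Rightarrow> ('a \<Rightarrow> 'a \<Rightarrow> real) \<Rightarrow> 'a set \<Rightarrow> ennreal" where
  "hausdorff_measure s d A =
     (SUP \<delta>\<in>{0::real<..}.
        INF E\<in>{E :: nat \<Rightarrow> 'a set. A \<subseteq> (\<Union>i. E i) \<and> (\<forall>i. diam_of d (E i) \<le> ennreal \<delta>)}.
          \<Sum>i. if E i = {} then 0 else diam_of d (E i) ^ s)"


section \<open>BiLipschitz maps and biLipschitz equivalence\<close>

definition bilipschitz_map :: "('a \<Rightarrow> 'a \<Rightarrow> real) \<Rightarrow> ('a \<Rightarrow> 'a) \<Rightarrow> bool" where
  "bilipschitz_map d f \<longleftrightarrow>
     (\<exists>L\<ge>1. \<forall>p q. 1 / L * d p q \<le> d (f p) (f q) \<and> d (f p) (f q) \<le> L * d p q)"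

definition bilipschitz_equivalent_on ::
  "'a set \<Rightarrow> ('a \<Rightarrow> 'a \<Rightarrow> real) \<Rightarrow> ('a \<Rightarrow> 'a \<Rightarrow> real) \<Rightarrow> bool" where
  "bilipschitz_equivalent_on K d d' \<longleftrightarrow>
     (\<exists>L\<ge>1. \<forall>p\<in>K. \<forall>q\<in>K. 1 / L * d' p q \<le> d p q \<and> d p q \<le> L * d' p q)"

end

theory Submission
  imports Defs
begin

text \<open>
  Since \<open>d\<close> is continuous, Baire's theorem makes the biLipschitz constants of the left translations
  locally uniform. Suppose that \<open>d\<close> and \<open>d\<^sub>c\<^sub>c\<close> are not biLipschitz equivalent on a compact set. Then
  there are arbitrarily small \<open>h\<close> with homogeneous gauge \<open>3\<rho>\<close> for which \<open>d(0, h) / \<rho>\<close> is as small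
  as we like. For fixed \<open>m\<close> and suitable \<open>h\<close>, the set \<open>E\<close> of all \<open>h\<^sup>j b\<close> with \<open>j < m\<close> and
  \<open>b\<close> in the box of size \<open>\<rho>\<close> then has \<open>d\<close>-diameter \<open>O(\<rho>)\<close>, with a constant independent of \<open>m\<close>,
  although it consists of \<open>m\<close> disjoint translates of the box and so has volume \<open>8m\<rho>\<^sup>4\<close>. If
  \<open>g\<^sub>1 E, \<dots>, g\<^sub>n E\<close> is a maximal disjoint family with all \<open>g\<^sub>i\<close> in a bounded set \<open>B\<close>, then the
  translates \<open>g\<^sub>i E E\<^sup>-\<^sup>1\<close> cover \<open>B\<close> and comparing volumes gives \<open>n = O(1 / (m\<rho>\<^sup>4))\<close>.
  Hence the Hausdorff 4-measure of \<open>B\<close> is \<open>O(1/m)\<close> for every \<open>m\<close>, so it vanishes, and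
  \<open>\<H>\<^sup>4\<^sub>d = 0\<close> by countable subadditivity.
\<close>


section \<open>The group and its homogeneous gauge\<close>

lemma hmult_nth [simp]:
  "(p \<odot> q) $ 1 = p$1 + q$1"
  "(p \<odot> q) $ 2 = p$2 + q$2"
  "(p \<odot> q) $ 3 = p$3 + q$3 + (p$1 * q$2 - p$2 * q$1) / 2"
  by (simp_all add: hmult_def)

lemma hmult_assoc: "(p \<odot> q) \<odot> r = p \<odot> (q \<odot> r)"
  by (simp add: vec_eq_iff forall_3 field_simps)

lemma hmult_0 [simp]: "0 \<odot> p = p" "p \<odot> 0 = p"
  by (simp_all add: vec_eq_iff forall_3)

lemma hmult_minus [simp]:
  "- p \<odot> p = 0" "p \<odot> (- p) = 0" "- p \<odot> (p \<odot> q) = q" "p \<odot> (- p \<odot> q) = q"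
  by (simp_all add: vec_eq_iff forall_3 field_simps)

text \<open>The commutator term vanishes on multiples of a single vector, so these form a
  one-parameter subgroup and \<open>real j *\<^sub>R h\<close> is the \<open>j\<close>-th power of
  \<open>h\<close>.\<close>

lemma hmult_scaleR: "(s *\<^sub>R h) \<odot> (t *\<^sub>R h) = (s + t) *\<^sub>R h"
  by (simp add: vec_eq_iff forall_3 field_simps)

lemma continuous_on_hmult [continuous_intros]:
  assumes "continuous_on S f" "continuous_on S g"
  shows "continuous_on S (\<lambda>x. f x \<odot> g x)"
proof -
  have "continuous_on S (\<lambda>x. \<chi> i. (f x \<odot> g x) $ i)"
  proof (rule continuous_on_vec_lambda)
    fix i :: 3
    show "continuous_on S (\<lambda>x. (f x \<odot> g x) $ i)"
      using exhaust_3[of i] by (elim disjE) (auto intro!: continuous_intros assms)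
  qed
  then show ?thesis by simp
qed

section \<open>Boxes as closed balls of a homogeneous gauge\<close>

definition heis_box :: "real \<Rightarrow> heis set" where
  "heis_box r = cbox (- vector [r, r, r\<^sup>2]) (vector [r, r, r\<^sup>2])"

text \<open>Homogeneous of degree 1 under the dilations (x, y, z) -> (t x, t y, t^2 z) with t > 0;
  the square root reflects that the centre scales quadratically.\<close>

definition heis_gauge :: "heis \<Rightarrow> real" where
  "heis_gauge h = max (max \<bar>h$1\<bar> \<bar>h$2\<bar>) (sqrt \<bar>h$3\<bar>)"

lemma mem_heis_box: "h \<in> heis_box r \<longleftrightarrow> \<bar>h$1\<bar> \<le> r \<and> \<bar>h$2\<bar> \<le> r \<and> \<bar>h$3\<bar> \<le> r\<^sup>2"
  by (auto simp: heis_box_def mem_box_cart forall_3 abs_le_iff)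

lemma mem_heis_box_iff_gauge: "0 \<le> r \<Longrightarrow> h \<in> heis_box r \<longleftrightarrow> heis_gauge h \<le> r"
  by (auto simp: mem_heis_box heis_gauge_def real_sqrt_le_iff' intro: real_le_lsqrt dest: sqrt_le_D)

lemma heis_gauge_nonneg [simp]: "0 \<le> heis_gauge h"
  by (simp add: heis_gauge_def le_max_iff_disj)

lemma heis_gauge_0 [simp]: "heis_gauge 0 = 0"
  by (simp add: heis_gauge_def)

lemma heis_gauge_le_scaleR:
  assumes "1 \<le> t"
  shows "heis_gauge h \<le> heis_gauge (t *\<^sub>R h)"
proof -
  have "\<bar>h$i\<bar> \<le> \<bar>t * h$i\<bar>" for i
    using assms mult_right_mono[of 1 t "\<bar>h$i\<bar>"] by (simp add: abs_mult)
  then show ?thesis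
    unfolding heis_gauge_def by (intro max.mono real_sqrt_le_mono) auto
qed

lemma continuous_on_heis_gauge [continuous_intros]:
  "continuous_on S f \<Longrightarrow> continuous_on S (\<lambda>x. heis_gauge (f x))"
  unfolding heis_gauge_def by (intro continuous_intros)

lemma heis_box_mono: "0 \<le> r \<Longrightarrow> r \<le> s \<Longrightarrow> heis_box r \<subseteq> heis_box s"
  using mem_heis_box_iff_gauge by fastforce

lemma heis_box_minus: "h \<in> heis_box r \<Longrightarrow> - h \<in> heis_box r"
  by (simp add: mem_heis_box)

text \<open>The commutator term is at most r s in absolute value, and (r + s)^2 leaves room 2 r s
  for it. In other words, the gauge is subadditive.\<close>

lemma heis_box_hmult:
  assumes "p \<in> heis_box r" "q \<in> heis_box s"
  shows "p \<odot> q \<in> heis_box (r + s)"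
proof -
  have le: "\<bar>p$1\<bar> \<le> r" "\<bar>p$2\<bar> \<le> r" "\<bar>p$3\<bar> \<le> r\<^sup>2" "\<bar>q$1\<bar> \<le> s" "\<bar>q$2\<bar> \<le> s" "\<bar>q$3\<bar> \<le> s\<^sup>2"
    using assms by (auto simp: mem_heis_box)
  then have nonneg: "0 \<le> r" "0 \<le> s"
    by auto
  have "\<bar>p$1 * q$2\<bar> \<le> r * s" "\<bar>p$2 * q$1\<bar> \<le> r * s"
    using le nonneg by (auto simp: abs_mult intro!: mult_mono)
  moreover have "0 \<le> r * s"
    using nonneg by simp
  moreover have "\<bar>x + y + (u - v) / 2\<bar> \<le> a + b + 2 * c"
    if "\<bar>x\<bar> \<le> a" "\<bar>y\<bar> \<le> b" "\<bar>u\<bar> \<le> c" "\<bar>v\<bar> \<le> c" "0 \<le> c" for x y u v a b c :: real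
    using that by (auto simp: abs_le_iff field_simps)
  ultimately have "\<bar>(p \<odot> q)$3\<bar> \<le> (r + s)\<^sup>2"
    using le(3,6) by (simp add: power2_sum mult.assoc)
  moreover have "\<bar>(p \<odot> q)$1\<bar> \<le> r + s" "\<bar>(p \<odot> q)$2\<bar> \<le> r + s"
    using le(1,2,4,5) by (auto intro: order_trans[OF abs_triangle_ineq])
  ultimately show ?thesis
    unfolding mem_heis_box by blast
qed

lemma compact_heis_box [simp]: "compact (heis_box r)"
  by (simp add: heis_box_def)

lemma bounded_imp_subset_heis_box:
  assumes "bounded S"
  obtains r where "1 \<le> r" "S \<subseteq> heis_box r"
proof -
  obtain B where B: "\<And>x. x \<in> S \<Longrightarrow> norm x \<le> B"
    using assms bounded_iff by metis
  \<comment> \<open>The lower bound 1 gives r \<le> r^2, so a bound by r also suffices for the third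
    coordinate.\<close>
  define r where "r = max 1 B"
  have "h \<in> heis_box r" if "h \<in> S" for h
  proof -
    have "\<bar>h$i\<bar> \<le> r" for i
      using component_le_norm_cart[of h i] B[OF that] by (simp add: r_def)
    moreover have "r \<le> r\<^sup>2"
      by (rule self_le_power) (auto simp: r_def)
    ultimately show ?thesis
      unfolding mem_heis_box by (meson order_trans)
  qed
  then show thesis using that[of r] by (auto simp: r_def)
qed

lemma Un_heis_box: "(\<Union>n. heis_box (real n)) = UNIV"
proof -
  have "\<exists>n. h \<in> heis_box (real n)" for h
    using real_arch_simple[of "heis_gauge h"] mem_heis_box_iff_gauge by auto
  then show ?thesis by auto
qed

section \<open>Left-invariant volume\<close>

lemma lmeasurable_heis_box [simp]: "heis_box r \<in> lmeasurable"
  by (simp add: heis_box_def)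

text \<open>The exponent 4 = 1 + 1 + 2 is the homogeneous dimension. It agrees with the exponent of
  the Hausdorff measure, so that counting by volume is scale invariant.\<close>

lemma measure_heis_box:
  assumes "0 \<le> r"
  shows "measure lebesgue (heis_box r) = 8 * r ^ 4"
proof -
  have "0 \<in> heis_box r"
    using assms by (simp add: mem_heis_box)
  then have "measure lebesgue (heis_box r) =
      (\<Prod>i\<in>UNIV. vector [r, r, r\<^sup>2] $ i - (- vector [r, r, r\<^sup>2] :: heis) $ i)"
    unfolding heis_box_def by (subst content_cbox_cart[symmetric]) auto
  also have "\<dots> = (2 * r) * ((2 * r) * (2 * r\<^sup>2))"
    unfolding UNIV_3 by simp
  finally show ?thesis
    by (simp add: power2_eq_square power4_eq_xxxx)
qed

text \<open>Left translation by \<open>g\<close> is a shear of determinant 1 followed by the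
  Euclidean translation by \<open>g\<close>.\<close>

lemma
  assumes "S \<in> lmeasurable"
  shows lmeasurable_hmult: "(\<odot>) g ` S \<in> lmeasurable"
    and measure_hmult: "measure lebesgue ((\<odot>) g ` S) = measure lebesgue S"
proof -
  define A :: "heis \<Rightarrow> heis"
    where "A h = vector [h$1, h$2, h$3 + (g$1 * h$2 - g$2 * h$1) / 2]" for h
  have lin: "linear A"
    by (rule linearI) (simp_all add: A_def vec_eq_iff forall_3 field_simps)
  have "det (matrix A) = 1"
    by (simp add: det_3 matrix_def A_def axis_def)
  moreover have "(\<odot>) g ` S = (\<lambda>x. g + x) ` (A ` S)"
    by (auto simp: image_image A_def vec_eq_iff forall_3 intro!: image_cong)
  ultimately show "(\<odot>) g ` S \<in> lmeasurable"
    and "measure lebesgue ((\<odot>) g ` S) = measure lebesgue S"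
    using assms lin
    by (simp_all add: measurable_translation measure_translation measurable_linear_image measure_linear_image)
qed

section \<open>Upper bound for the Carnot-Caratheodory distance\<close>

lemma has_vector_derivative_vector_3:
  assumes "(f has_real_derivative f') F" "(g has_real_derivative g') F" "(h has_real_derivative h') F"
  shows "((\<lambda>t. vector [f t, g t, h t] :: real ^ 3) has_vector_derivative vector [f', g', h']) F"
proof -
  have *: "(vector [a, b, c] :: real ^ 3) = a *\<^sub>R axis 1 1 + b *\<^sub>R axis 2 1 + c *\<^sub>R axis 3 1" for a b c
    by (simp add: vec_eq_iff forall_3 axis_def)
  show ?thesis
    unfolding *
    by (intro has_vector_derivative_add assms
        bounded_linear.has_vector_derivative[OF bounded_linear_scaleR_left]
        assms[unfolded has_real_derivative_iff_has_vector_derivative])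
qed

lemma lipschitz_imp_abs_cont_on:
  assumes "\<And>s t. s \<in> {a..b} \<Longrightarrow> t \<in> {a..b} \<Longrightarrow> norm (\<gamma> s - \<gamma> t) \<le> B * \<bar>s - t\<bar>"
  shows "abs_cont_on a b \<gamma>"
  unfolding abs_cont_on_def
proof (intro allI impI)
  fix \<epsilon> :: real assume "0 < \<epsilon>"
  define B' where "B' = max B 1"
  have "(\<Sum>K\<in>\<D>. norm (\<gamma> (Sup K) - \<gamma> (Inf K))) < \<epsilon>"
    if \<D>: "\<D> division_of S" and S: "S \<subseteq> {a..b}" and small: "(\<Sum>K\<in>\<D>. Sup K - Inf K) < \<epsilon> / B'" for \<D> S
  proof -
    have "norm (\<gamma> (Sup K) - \<gamma> (Inf K)) \<le> B' * (Sup K - Inf K)" if K: "K \<in> \<D>" for K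
    proof -
      obtain u v where uv: "K = {u..v}" "K \<subseteq> S" "K \<noteq> {}"
        using division_ofD(2,3,4)[OF \<D> K] by (metis cbox_interval)
      then have "u \<le> v" "u \<in> S" "v \<in> S"
        by auto
      then have "u \<in> {a..b}" "v \<in> {a..b}"
        using S by auto
      then have "norm (\<gamma> v - \<gamma> u) \<le> B * (v - u)"
        using assms[of v u] \<open>u \<le> v\<close> by simp
      also have "\<dots> \<le> B' * (v - u)"
        using \<open>u \<le> v\<close> by (intro mult_right_mono) (auto simp: B'_def)
      finally show ?thesis
        using uv \<open>u \<le> v\<close> by simp
    qed
    then have "(\<Sum>K\<in>\<D>. norm (\<gamma> (Sup K) - \<gamma> (Inf K))) \<le> B' * (\<Sum>K\<in>\<D>. Sup K - Inf K)"
      by (simp add: sum_distrib_left sum_mono)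
    also have "\<dots> < \<epsilon>"
      using small by (simp add: B'_def field_simps less_max_iff_disj)
    finally show ?thesis .
  qed
  moreover have "0 < \<epsilon> / B'"
    using \<open>0 < \<epsilon>\<close> by (simp add: B'_def less_max_iff_disj)
  ultimately show "\<exists>\<delta>>0. \<forall>\<D> S. \<D> division_of S \<and> S \<subseteq> {a..b} \<and> (\<Sum>K\<in>\<D>. Sup K - Inf K) < \<delta> \<longrightarrow>
        (\<Sum>K\<in>\<D>. norm (\<gamma> (Sup K) - \<gamma> (Inf K))) < \<epsilon>"
    by (intro exI[of _ "\<epsilon> / B'"]) auto
qed

section \<open>Lengths of horizontal curves\<close>

lemma horizontal_norm_nonneg:
  assumes "v \<in> span {X_field p, Y_field p}"
  shows "0 \<le> horizontal_norm p v"
proof -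
  obtain \<alpha> \<beta> where "v = \<alpha> *\<^sub>R X_field p + \<beta> *\<^sub>R Y_field p"
    using assms by (auto simp: span_insert algebra_simps)
  then show ?thesis by (simp add: horizontal_norm_eq)
qed

text \<open>The integrand is nonnegative wherever the derivative is horizontal, hence almost
  everywhere. This bounds from below the set whose infimum is \<open>cc_dist\<close>.\<close>

lemma cc_length_nonneg:
  assumes "horizontal_curve a b \<gamma>"
  shows "0 \<le> cc_length a b \<gamma>"
  unfolding cc_length_def
proof (rule integral_nonneg_AE)
  have "AE t in lebesgue_on {a..b}. \<gamma> differentiable (at t) \<and>
        vector_derivative \<gamma> (at t) \<in> span {X_field (\<gamma> t), Y_field (\<gamma> t)}"
    using assms by (simp add: horizontal_curve_def)
  then show "AE t in lebesgue_on {a..b}. 0 \<le> horizontal_norm (\<gamma> t) (vector_derivative \<gamma> (at t))"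
    by eventually_elim (auto intro: horizontal_norm_nonneg)
qed

lemma cc_dist_le_cc_length:
  assumes "horizontal_curve a b \<gamma>"
  shows "cc_dist (\<gamma> a) (\<gamma> b) \<le> cc_length a b \<gamma>"
  unfolding cc_dist_def
  using assms by (intro cInf_lower bdd_belowI[of _ 0]) (auto intro: cc_length_nonneg)

text \<open>A planar curve from the origin lifts to a horizontal curve whose third coordinate is the
  signed area swept out. Left translation by \<open>p\<close> preserves the horizontal fields, and
  the length is at most the integral of |c1'| + |c2'|.\<close>

lemma cc_dist_le_planar_lift:
  fixes c1 c2 c3 :: "real \<Rightarrow> real"
  assumes c1: "\<And>t. (c1 has_real_derivative c1' t) (at t)"
    and c2: "\<And>t. (c2 has_real_derivative c2' t) (at t)"
    and c3: "\<And>t. (c3 has_real_derivative (c1 t * c2' t - c2 t * c1' t) / 2) (at t)"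
    and 0: "c1 0 = 0" "c2 0 = 0" "c3 0 = 0"
    and A: "\<And>t. t \<in> {0..1} \<Longrightarrow> \<bar>c1' t\<bar> \<le> A"
    and B: "\<And>t. t \<in> {0..1} \<Longrightarrow> \<bar>c2' t\<bar> \<le> B"
  shows "cc_dist p (p \<odot> vector [c1 1, c2 1, c3 1]) \<le> A + B"
proof -
  have AB: "0 \<le> A" "0 \<le> B"
    using A[of 0] B[of 0] by auto
  define \<gamma> where "\<gamma> t = p \<odot> vector [c1 t, c2 t, c3 t]" for t
  define \<gamma>' where "\<gamma>' t = c1' t *\<^sub>R X_field (\<gamma> t) + c2' t *\<^sub>R Y_field (\<gamma> t)" for t
  have der: "(\<gamma> has_vector_derivative \<gamma>' t) (at t)" for t
  proof -
    have "((\<lambda>t. vector [p$1 + c1 t, p$2 + c2 t, p$3 + c3 t + (p$1 * c2 t - p$2 * c1 t) / 2] :: heis)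
        has_vector_derivative vector [c1' t, c2' t, (c1 t * c2' t - c2 t * c1' t) / 2
          + (p$1 * c2' t - p$2 * c1' t) / 2]) (at t)"
      by (intro has_vector_derivative_vector_3) (auto intro!: derivative_eq_intros c1 c2 c3)
    moreover have "vector [c1' t, c2' t, (c1 t * c2' t - c2 t * c1' t) / 2
          + (p$1 * c2' t - p$2 * c1' t) / 2] = \<gamma>' t"
      by (simp add: vec_eq_iff forall_3 \<gamma>'_def \<gamma>_def X_field_def Y_field_def field_simps)
    moreover have "\<gamma> = (\<lambda>t. vector [p$1 + c1 t, p$2 + c2 t, p$3 + c3 t + (p$1 * c2 t - p$2 * c1 t) / 2])"
      by (simp add: \<gamma>_def hmult_def fun_eq_iff)
    ultimately show ?thesis by simp
  qed
  have cont: "continuous_on {0..1} \<gamma>"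
    using der by (meson continuous_at_imp_continuous_on has_vector_derivative_continuous)
  \<comment> \<open>The derivatives c1' and c2' are bounded but not assumed continuous, so \<gamma>'
    is bounded through the continuity of the two fields along \<gamma>; then \<gamma> is Lipschitz,
    hence absolutely continuous.\<close>
  have "continuous_on {0..1} (\<lambda>t. A * norm (X_field (\<gamma> t)) + B * norm (Y_field (\<gamma> t)))"
  proof -
    have X: "X_field q = axis 1 1 + (- q$2 / 2) *\<^sub>R axis 3 1" for q
      by (simp add: vec_eq_iff forall_3 X_field_def axis_def)
    have Y: "Y_field q = axis 2 1 + (q$1 / 2) *\<^sub>R axis 3 1" for q
      by (simp add: vec_eq_iff forall_3 Y_field_def axis_def)
    have "continuous_on {0..1} (\<lambda>t. X_field (\<gamma> t))" "continuous_on {0..1} (\<lambda>t. Y_field (\<gamma> t))"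
      unfolding X Y by (auto intro!: continuous_intros cont)
    then show ?thesis by (intro continuous_intros)
  qed
  then have "bdd_above ((\<lambda>t. A * norm (X_field (\<gamma> t)) + B * norm (Y_field (\<gamma> t))) ` {0..1})"
    by (intro bounded_imp_bdd_above compact_imp_bounded compact_continuous_image) simp_all
  then obtain C where C: "\<And>t. t \<in> {0..1} \<Longrightarrow> A * norm (X_field (\<gamma> t)) + B * norm (Y_field (\<gamma> t)) \<le> C"
    unfolding bdd_above_def by blast
  have C': "norm (\<gamma>' t) \<le> C" if "t \<in> {0..1}" for t
  proof -
    have "norm (\<gamma>' t) \<le> \<bar>c1' t\<bar> * norm (X_field (\<gamma> t)) + \<bar>c2' t\<bar> * norm (Y_field (\<gamma> t))"
      unfolding \<gamma>'_def by (metis norm_scaleR norm_triangle_ineq)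
    also have "\<dots> \<le> A * norm (X_field (\<gamma> t)) + B * norm (Y_field (\<gamma> t))"
      using A B that by (intro add_mono mult_right_mono) auto
    finally show ?thesis using C[OF that] by simp
  qed
  have "norm (\<gamma> s - \<gamma> t) \<le> C * norm (s - t)" if "s \<in> {0..1}" "t \<in> {0..1}" for s t
  proof (rule differentiable_bound[where S = "{0..1}" and f' = "\<lambda>t h. h *\<^sub>R \<gamma>' t"])
    show "(\<gamma> has_derivative (\<lambda>h. h *\<^sub>R \<gamma>' t)) (at t within {0..1})" for t
      using der unfolding has_vector_derivative_def by (rule has_derivative_at_withinI)
    show "onorm (\<lambda>h. h *\<^sub>R \<gamma>' t) \<le> C" if "t \<in> {0..1}" for t
      using mult_right_mono[OF C'[OF that] abs_ge_zero]
      by (intro onorm_le) (simp add: mult.commute)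
  qed (use that in auto)
  then have ac: "abs_cont_on 0 1 \<gamma>"
    by (intro lipschitz_imp_abs_cont_on) auto
  have hor: "horizontal_curve 0 1 \<gamma>"
    unfolding horizontal_curve_def
  proof (intro conjI AE_I2 ac)
    fix t
    show "\<gamma> differentiable at t"
      using der by (metis differentiableI_vector)
    show "vector_derivative \<gamma> (at t) \<in> span {X_field (\<gamma> t), Y_field (\<gamma> t)}"
      by (simp add: vector_derivative_at[OF der] \<gamma>'_def span_add span_base span_scale)
  qed simp
  have "cc_length 0 1 \<gamma> \<le> (LINT t|lebesgue_on {0..1::real}. A + B)"
    unfolding cc_length_def
  \<comment> \<open>Only the dominating constant has to be integrable: a non-integrable integrand
    has integral 0 by convention, and 0 \<le> A + B.\<close>
  proof (rule integral_mono')
    show "integrable (lebesgue_on {0..1}) (\<lambda>x::real. A + B)"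
      by (intro finite_measure.integrable_const finite_measure_lebesgue_on) simp
    fix t :: real assume "t \<in> space (lebesgue_on {0..1})"
    then have "\<bar>c1' t\<bar> \<le> A" "\<bar>c2' t\<bar> \<le> B"
      using A B by auto
    then show "horizontal_norm (\<gamma> t) (vector_derivative \<gamma> (at t)) \<le> A + B"
      using sqrt_sum_squares_le_sum_abs[of "c1' t" "c2' t"]
      by (simp add: vector_derivative_at[OF der] \<gamma>'_def horizontal_norm_eq)
  qed (use AB in auto)
  also have "\<dots> = A + B"
    by (simp add: measure_restrict_space)
  finally have "cc_dist (\<gamma> 0) (\<gamma> 1) \<le> A + B"
    using cc_dist_le_cc_length[OF hor] by simp
  moreover have "\<gamma> 0 = p"
    using 0 by (simp add: \<gamma>_def vec_eq_iff forall_3)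
  ultimately show ?thesis by (simp add: \<gamma>_def)
qed

lemma cc_dist_le_gauge: "cc_dist p (p \<odot> h) \<le> 30 * heis_gauge h"
proof -
  \<comment> \<open>The planar projection of the curve is a segment plus the loop \<open>(a \<phi>, b \<psi>)\<close>. As \<open>\<phi>\<close> and \<open>\<psi>\<close>
    have mean \<open>0\<close> on \<open>[0, 1]\<close>, only the loop contributes to the enclosed area; its area is
    \<open>-a b / 70\<close>.\<close>
  define a where "a = sqrt (70 * \<bar>h$3\<bar>)"
  define b where "b = - sgn (h$3) * a"
  have aa: "a * a = 70 * \<bar>h$3\<bar>"
    by (simp add: a_def)
  have ab: "a * b = - 70 * h$3"
  proof -
    have "a * b = - sgn (h$3) * (a * a)" by (simp add: b_def)
    then show ?thesis using sgn_mult_abs[of "h$3"] by (simp add: aa)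
  qed
  have abs_b: "\<bar>b\<bar> \<le> a" and a0: "0 \<le> a"
    by (auto simp: b_def a_def abs_mult sgn_if)
  have a_le: "a \<le> 9 * sqrt \<bar>h$3\<bar>"
  proof -
    have "sqrt 70 \<le> 9" by (rule real_le_lsqrt) auto
    then show ?thesis unfolding a_def real_sqrt_mult by (intro mult_right_mono) auto
  qed
  define \<phi> \<phi>' \<psi> \<psi>' :: "real \<Rightarrow> real"
    where "\<phi> t = t - 3 * t^2 + 2 * t^3" and "\<phi>' t = 1 - 6 * (t * (1 - t))"
      and "\<psi> t = t - 6 * t^2 + 10 * t^3 - 5 * t^4"
      and "\<psi>' t = (1 - 2 * t) * (1 - 10 * (t * (1 - t)))" for t
  \<comment> \<open>Antiderivatives vanishing at 0 of the area forms of the pairs (t, \<psi>),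
    (\<phi>, t) and (\<phi>, \<psi>). At 1, \<open>F\<close> and \<open>G\<close> vanish and
    \<open>H\<close> is -1/35, so \<open>c3\<close> ends at -a b / 70, which is the third coordinate
    of \<open>h\<close>.\<close>
  define F G H :: "real \<Rightarrow> real"
    where "F t = t * \<psi> t - t^2 + 4 * t^3 - 5 * t^4 + 2 * t^5"
      and "G t = (t - t^2)^2 - t * \<phi> t"
      and "H t = - (t^3) + 4 * t^4 - 33/5 * t^5 + 5 * t^6 - 10/7 * t^7" for t
  define c1 c2 c1' c2' c3
    where "c1 t = h$1 * t + a * \<phi> t" and "c2 t = h$2 * t + b * \<psi> t"
      and "c1' t = h$1 + a * \<phi>' t" and "c2' t = h$2 + b * \<psi>' t"
      and "c3 t = (b * h$1 * F t + a * h$2 * G t + a * b * H t) / 2" for t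
  note defs = \<phi>_def \<phi>'_def \<psi>_def \<psi>'_def F_def G_def H_def
    c1_def c2_def c1'_def c2'_def c3_def
  have \<phi>: "(\<phi> has_real_derivative \<phi>' t) (at t)" for t
    unfolding \<phi>_def \<phi>'_def
    by (rule derivative_eq_intros refl)+ (simp add: algebra_simps power2_eq_square)
  have \<psi>: "(\<psi> has_real_derivative \<psi>' t) (at t)" for t
    unfolding \<psi>_def \<psi>'_def
    by (rule derivative_eq_intros refl)+ (simp add: algebra_simps power2_eq_square power3_eq_cube)
  have F: "(F has_real_derivative t * \<psi>' t - \<psi> t) (at t)" for t
    unfolding F_def
    by (rule derivative_eq_intros refl \<psi>)+ (simp add: \<psi>_def algebra_simps power2_eq_square)
  have G: "(G has_real_derivative \<phi> t - t * \<phi>' t) (at t)" for t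
    unfolding G_def
    by (rule derivative_eq_intros refl \<phi>)+
       (simp add: \<phi>_def algebra_simps power2_eq_square power3_eq_cube)
  have H: "(H has_real_derivative \<phi> t * \<psi>' t - \<psi> t * \<phi>' t) (at t)" for t
  proof -
    have "(H has_real_derivative - 3 * t^2 + 16 * t^3 - 33 * t^4 + 30 * t^5 - 10 * t^6) (at t)"
      unfolding H_def by (rule derivative_eq_intros refl)+ simp
    moreover have "- 3 * t^2 + 16 * t^3 - 33 * t^4 + 30 * t^5 - 10 * t^6 = \<phi> t * \<psi>' t - \<psi> t * \<phi>' t"
      unfolding \<phi>_def \<psi>_def \<phi>'_def \<psi>'_def by algebra
    ultimately show ?thesis by simp
  qed
  have u: "0 \<le> t * (1 - t)" "t * (1 - t) \<le> 1/4" if "t \<in> {0..1}" for t :: real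
    using that zero_le_power2[of "t - 1/2"]
    by (simp, simp add: power2_eq_square algebra_simps)
  have "cc_dist p (p \<odot> vector [c1 1, c2 1, c3 1]) \<le> (\<bar>h$1\<bar> + a) + (\<bar>h$2\<bar> + 2 * a)"
  proof (rule cc_dist_le_planar_lift[where c1' = c1' and c2' = c2'])
    show "(c1 has_real_derivative c1' t) (at t)" for t
      unfolding c1_def c1'_def by (rule derivative_eq_intros refl \<phi>)+ simp
    show "(c2 has_real_derivative c2' t) (at t)" for t
      unfolding c2_def c2'_def by (rule derivative_eq_intros refl \<psi>)+ simp
    show "(c3 has_real_derivative (c1 t * c2' t - c2 t * c1' t) / 2) (at t)" for t
    proof -
      have "((\<lambda>t. b * h$1 * F t + a * h$2 * G t + a * b * H t)
          has_real_derivative c1 t * c2' t - c2 t * c1' t) (at t)"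
        unfolding c1_def c2_def c1'_def c2'_def
        by (rule derivative_eq_intros refl F G H)+ (simp add: algebra_simps)
      then show ?thesis
        unfolding c3_def by (rule DERIV_cdivide)
    qed
    fix t :: real assume t: "t \<in> {0..1}"
    have "\<bar>a * (1 - 6 * (t * (1 - t)))\<bar> \<le> a * 1"
      unfolding abs_mult using u[OF t] a0 by (intro mult_mono) auto
    then show "\<bar>c1' t\<bar> \<le> \<bar>h$1\<bar> + a"
      unfolding c1'_def \<phi>'_def by linarith
    have "\<bar>1 - 2 * t\<bar> \<le> 1" "\<bar>1 - 10 * (t * (1 - t))\<bar> \<le> 2"
      using u[OF t] t unfolding abs_le_iff atLeastAtMost_iff by linarith+
    then have "\<bar>(1 - 2 * t) * (1 - 10 * (t * (1 - t)))\<bar> \<le> 1 * 2"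
      unfolding abs_mult by (intro mult_mono) auto
    then have "\<bar>b * ((1 - 2 * t) * (1 - 10 * (t * (1 - t))))\<bar> \<le> a * 2"
      unfolding abs_mult[of b] using a0 abs_b by (intro mult_mono) auto
    then show "\<bar>c2' t\<bar> \<le> \<bar>h$2\<bar> + 2 * a"
      unfolding c2'_def \<psi>'_def by linarith
  qed (simp_all add: defs)
  moreover have "vector [c1 1, c2 1, c3 1] = h"
    using ab by (simp add: vec_eq_iff forall_3 defs)
  moreover have "\<bar>h$1\<bar> \<le> heis_gauge h" "\<bar>h$2\<bar> \<le> heis_gauge h" "sqrt \<bar>h$3\<bar> \<le> heis_gauge h"
    by (auto simp: heis_gauge_def)
  \<comment> \<open>The first two coordinates contribute at most 2 and 3 a at most 27 times the
    gauge; 29 is rounded up to 30.\<close>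
  ultimately show ?thesis
    using a_le by simp
qed

section \<open>Null sets of Hausdorff measures\<close>

abbreviation hausdorff_cost :: "nat \<Rightarrow> ('a \<Rightarrow> 'a \<Rightarrow> real) \<Rightarrow> (nat \<Rightarrow> 'a set) \<Rightarrow> ennreal" where
  "hausdorff_cost s d E \<equiv> \<Sum>i. if E i = {} then 0 else diam_of d (E i) ^ s"

lemma INF_ennreal_eq_0_iff:
  fixes f :: "'a \<Rightarrow> ennreal"
  shows "(INF x\<in>S. f x) = 0 \<longleftrightarrow> (\<forall>\<eta>>0. \<exists>x\<in>S. f x \<le> ennreal \<eta>)"
proof
  assume *: "(INF x\<in>S. f x) = 0"
  show "\<forall>\<eta>>0. \<exists>x\<in>S. f x \<le> ennreal \<eta>"
  proof (intro allI impI)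
    fix \<eta> :: real assume "0 < \<eta>"
    then have "(INF x\<in>S. f x) < ennreal \<eta>"
      by (simp add: *)
    then show "\<exists>x\<in>S. f x \<le> ennreal \<eta>"
      by (auto simp: INF_less_iff intro: less_imp_le)
  qed
next
  assume *: "\<forall>\<eta>>0. \<exists>x\<in>S. f x \<le> ennreal \<eta>"
  have "(INF x\<in>S. f x) \<le> 0 + ennreal \<eta>" if "0 < \<eta>" for \<eta>
    using * that by (auto intro: INF_lower2)
  then have "(INF x\<in>S. f x) \<le> 0"
    by (rule ennreal_le_epsilon)
  then show "(INF x\<in>S. f x) = 0" by simp
qed

lemma hausdorff_measure_eq_0_iff:
  "hausdorff_measure s d A = 0 \<longleftrightarrow>
    (\<forall>\<delta>>0. \<forall>\<eta>>0. \<exists>E. A \<subseteq> (\<Union>i. E i) \<and> (\<forall>i. diam_of d (E i) \<le> ennreal \<delta>) \<and>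
      hausdorff_cost s d E \<le> ennreal \<eta>)"
proof -
  have "(SUP x\<in>S. f x) = 0 \<longleftrightarrow> (\<forall>x\<in>S. f x = 0)" for S and f :: "real \<Rightarrow> ennreal"
    unfolding bot_ennreal[symmetric] by (rule SUP_bot_conv)
  then show ?thesis
    unfolding hausdorff_measure_def
    by (simp add: INF_ennreal_eq_0_iff Ball_def Bex_def conj_assoc del: UN_simps)
qed

text \<open>The n-th set gets a cover of cost at most \<eta> / 2^(n+1), and the covers are merged
  into one sequence by the pairing of natural numbers.\<close>

lemma hausdorff_measure_UN_null:
  fixes A :: "nat \<Rightarrow> 'a set"
  assumes "\<And>n. hausdorff_measure s d (A n) = 0"
  shows "hausdorff_measure s d (\<Union>n. A n) = 0"
  unfolding hausdorff_measure_eq_0_iff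
proof (intro allI impI)
  fix \<delta> \<eta> :: real assume "0 < \<delta>" "0 < \<eta>"
  then have "\<forall>n. \<exists>E. A n \<subseteq> (\<Union>i. E i) \<and> (\<forall>i. diam_of d (E i) \<le> ennreal \<delta>) \<and>
      hausdorff_cost s d E \<le> ennreal (\<eta> * (1/2) ^ Suc n)"
    using assms unfolding hausdorff_measure_eq_0_iff by simp
  from choice[OF this] obtain E where
    "\<forall>n. A n \<subseteq> (\<Union>i. E n i) \<and> (\<forall>i. diam_of d (E n i) \<le> ennreal \<delta>) \<and>
      hausdorff_cost s d (E n) \<le> ennreal (\<eta> * (1/2) ^ Suc n)" ..
  then have E: "\<And>n. A n \<subseteq> (\<Union>i. E n i)" "\<And>n i. diam_of d (E n i) \<le> ennreal \<delta>"
      "\<And>n. hausdorff_cost s d (E n) \<le> ennreal (\<eta> * (1/2) ^ Suc n)"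
    by auto
  define E' where "E' k = case_prod E (prod_decode k)" for k
  have "hausdorff_cost s d E' =
      (\<Sum>k. case_prod (\<lambda>n i. if E n i = {} then 0 else diam_of d (E n i) ^ s) (prod_decode k))"
    unfolding E'_def split_beta ..
  also have "\<dots> = (\<Sum>n. hausdorff_cost s d (E n))"
    by (intro suminf_ennreal_2dimen) simp
  also have "\<dots> \<le> (\<Sum>n. ennreal (\<eta> * (1/2) ^ Suc n))"
    by (intro suminf_le E) auto
  also have "\<dots> = ennreal \<eta>"
  proof -
    have "(\<lambda>n. \<eta> * (1/2) ^ Suc n) sums (\<eta> * 1)"
      by (intro sums_mult power_half_series)
    then show ?thesis
      using \<open>0 < \<eta>\<close> by (subst suminf_ennreal2) (auto simp: sums_iff)
  qed
  finally have "hausdorff_cost s d E' \<le> ennreal \<eta>" .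
  moreover have "(\<Union>n. A n) \<subseteq> (\<Union>k. E' k)"
  proof
    fix x assume "x \<in> (\<Union>n. A n)"
    then obtain n i where "x \<in> E n i"
      using E(1) by blast
    then have "x \<in> E' (prod_encode (n, i))"
      by (simp add: E'_def)
    then show "x \<in> (\<Union>k. E' k)" by blast
  qed
  moreover have "diam_of d (E' k) \<le> ennreal \<delta>" for k
    by (simp add: E'_def E(2) split_beta)
  ultimately show "\<exists>E. (\<Union>n. A n) \<subseteq> (\<Union>i. E i) \<and> (\<forall>i. diam_of d (E i) \<le> ennreal \<delta>) \<and>
      hausdorff_cost s d E \<le> ennreal \<eta>"
    by blast
qed

lemma hausdorff_cost_finite_cover:
  assumes "finite G" "A \<subseteq> (\<Union>g\<in>G. E g)" "\<And>g. g \<in> G \<Longrightarrow> diam_of d (E g) \<le> ennreal D" "0 \<le> D"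
  obtains E' where "A \<subseteq> (\<Union>i. E' i)" "\<And>i. diam_of d (E' i) \<le> ennreal D"
    "hausdorff_cost s d E' \<le> ennreal (real (card G) * D ^ s)"
proof -
  obtain h where h: "bij_betw h {0..<card G} G"
    using ex_bij_betw_nat_finite[OF \<open>finite G\<close>] by blast
  \<comment> \<open>Padding with empty sets, which have diameter 0 and cost 0.\<close>
  define E' where "E' i = (if i < card G then E (h i) else {})" for i
  have hG: "h i \<in> G" if "i < card G" for i
    using h that bij_betwE by fastforce
  have "hausdorff_cost s d E' = (\<Sum>i<card G. if E' i = {} then 0 else diam_of d (E' i) ^ s)"
    by (rule suminf_finite) (auto simp: E'_def)
  also have "\<dots> \<le> (\<Sum>i<card G. ennreal (D ^ s))"
  proof (rule sum_mono)
    fix i assume "i \<in> {..<card G}"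
    then have "diam_of d (E' i) \<le> ennreal D"
      by (simp add: E'_def assms(3) hG)
    then show "(if E' i = {} then 0 else diam_of d (E' i) ^ s) \<le> ennreal (D ^ s)"
      using \<open>0 \<le> D\<close> by (simp add: power_mono ennreal_power[symmetric])
  qed
  also have "\<dots> = ennreal (real (card G) * D ^ s)"
    using \<open>0 \<le> D\<close> by (simp add: ennreal_mult ennreal_of_nat_eq_real_of_nat)
  finally have "hausdorff_cost s d E' \<le> ennreal (real (card G) * D ^ s)" .
  moreover have "A \<subseteq> (\<Union>i. E' i)"
  proof
    fix x assume "x \<in> A"
    then obtain g where "g \<in> G" "x \<in> E g"
      using assms(2) by blast
    moreover then obtain i where "i < card G" "h i = g"
      using h by (metis atLeastLessThan_iff bij_betw_iff_bijections)
    ultimately have "x \<in> E' i" by (simp add: E'_def)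
    then show "x \<in> (\<Union>i. E' i)" by blast
  qed
  moreover have "diam_of d (E' i) \<le> ennreal D" for i
    by (simp add: E'_def assms(3) hG) (simp add: diam_of_def)
  ultimately show thesis using that by blast
qed

lemma diam_of_le:
  assumes "\<And>x y. x \<in> E \<Longrightarrow> y \<in> E \<Longrightarrow> d x y \<le> D"
  shows "diam_of d E \<le> ennreal D"
  unfolding diam_of_def using assms by (intro SUP_least ennreal_leI)

section \<open>Distances with biLipschitz left translations\<close>

locale heis_distance = Metric_space UNIV d for d :: "heis \<Rightarrow> heis \<Rightarrow> real" +
  assumes d_le_cc_dist: "d p q \<le> cc_dist p q"
    and bilipschitz_translation: "bilipschitz_map d (\<lambda>p. g \<odot> p)"
begin

section \<open>Continuity in the Euclidean topology\<close>

lemma d_le_gauge: "d p (p \<odot> h) \<le> 30 * heis_gauge h"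
  using d_le_cc_dist cc_dist_le_gauge by (rule order_trans)

text \<open>By the triangle inequality the change of \<open>d\<close> is at most 30 times the sum of
  the gauges of the two group increments, which is continuous and vanishes at the base
  point.\<close>

lemma continuous_on_d:
  assumes "continuous_on S f" "continuous_on S g"
  shows "continuous_on S (\<lambda>x. d (f x) (g x))"
  unfolding continuous_on_def
proof
  fix x assume x: "x \<in> S"
  let ?u = "\<lambda>y. 30 * heis_gauge (- f x \<odot> f y) + 30 * heis_gauge (- g x \<odot> g y)"
  have le: "norm (d (f y) (g y) - d (f x) (g x)) \<le> ?u y" for y
  proof -
    have "d (f x) (f y) \<le> 30 * heis_gauge (- f x \<odot> f y)" "d (g x) (g y) \<le> 30 * heis_gauge (- g x \<odot> g y)"
      using d_le_gauge[of "f x" "- f x \<odot> f y"] d_le_gauge[of "g x" "- g x \<odot> g y"] by simp_all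
    moreover have "d (f y) (g y) \<le> d (f x) (f y) + (d (f x) (g x) + d (g x) (g y))"
      using triangle[of "f y" "f x" "g y"] triangle[of "f x" "g x" "g y"] by (simp add: commute)
    moreover have "d (f x) (g x) \<le> d (f x) (f y) + (d (f y) (g y) + d (g x) (g y))"
      using triangle[of "f x" "f y" "g x"] triangle[of "f y" "g y" "g x"] by (simp add: commute)
    ultimately show ?thesis
      unfolding real_norm_def by (intro abs_leI; linarith)
  qed
  have "continuous_on S ?u"
    by (intro continuous_intros assms)
  then have "(?u \<longlongrightarrow> ?u x) (at x within S)"
    using x by (auto simp: continuous_on_def)
  then have "(?u \<longlongrightarrow> 0) (at x within S)" by simp
  then have "((\<lambda>y. d (f y) (g y) - d (f x) (g x)) \<longlongrightarrow> 0) (at x within S)"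
    by (rule Lim_null_comparison[rotated]) (intro always_eventually allI le)
  then show "((\<lambda>y. d (f y) (g y)) \<longlongrightarrow> d (f x) (g x)) (at x within S)"
    by (rule LIM_zero_cancel)
qed

section \<open>Locally uniform Lipschitz constants of left translations\<close>

lemma translation_lipschitz:
  obtains L where "1 \<le> L" "\<And>p q. d (g \<odot> p) (g \<odot> q) \<le> L * d p q"
  using bilipschitz_translation[of g] unfolding bilipschitz_map_def by auto

text \<open>Continuity of \<open>d\<close> makes these sets closed, and they exhaust the group as n
  grows. If all had empty interior, their complements would be dense open sets with empty
  intersection, against Baire's theorem.\<close>

lemma interior_translations_lipschitz:
  obtains n :: nat and a where "a \<in> interior {g. \<forall>p q. d (g \<odot> p) (g \<odot> q) \<le> real n * d p q}"
proof (rule ccontr)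
  define U where "U n = {g. \<forall>p q. d (g \<odot> p) (g \<odot> q) \<le> real n * d p q}" for n
  assume "\<not> thesis"
  then have int: "interior (U n) = {}" for n
    using that by (auto simp: U_def)
  have closed: "closed (U n)" for n
  proof -
    have "U n = (\<Inter>p. \<Inter>q. {g. d (g \<odot> p) (g \<odot> q) \<le> real n * d p q})"
      by (auto simp: U_def)
    moreover have "closed {g. d (g \<odot> p) (g \<odot> q) \<le> real n * d p q}" for p q
      by (intro closed_Collect_le continuous_on_d continuous_intros)
    ultimately show ?thesis by (simp add: closed_INT)
  qed
  have "UNIV \<subseteq> closure (\<Inter>(range (\<lambda>n. - U n)))"
  proof (rule Baire)
    fix T assume "T \<in> range (\<lambda>n. - U n)"
    then obtain n where T: "T = - U n" by blast
    show "openin (top_of_set UNIV) T \<and> UNIV \<subseteq> closure T"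
      using closed[of n] int[of n] by (simp add: T closure_complement open_Compl)
  qed auto
  moreover have "\<Inter>(range (\<lambda>n. - U n)) = {}"
  proof -
    have "\<exists>n. g \<in> U n" for g
    proof -
      obtain L where L: "\<And>p q. d (g \<odot> p) (g \<odot> q) \<le> L * d p q"
        using translation_lipschitz by blast
      obtain n where "L \<le> real n"
        using real_arch_simple by blast
      then have "g \<in> U n"
        unfolding U_def using L by (blast intro: order_trans mult_right_mono nonneg)
      then show ?thesis ..
    qed
    then show ?thesis by auto
  qed
  ultimately show False by simp
qed

text \<open>The neighbourhood of \<open>a\<close> is moved to each point c: a point g near c factors
  as (c a^-1)(a c^-1 g), where the first factor is fixed and the second lies near \<open>a\<close>.
  Compactness leaves finitely many c.\<close>

lemma uniform_translation_lipschitz: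
  assumes "compact C"
  obtains L where "1 \<le> L" "\<And>g p q. g \<in> C \<Longrightarrow> d (g \<odot> p) (g \<odot> q) \<le> L * d p q"
proof -
  obtain n :: nat and a where a: "a \<in> interior {g. \<forall>p q. d (g \<odot> p) (g \<odot> q) \<le> real n * d p q}"
    (is "_ \<in> interior ?U")
    by (rule interior_translations_lipschitz)
  define V where "V c = (\<lambda>g. a \<odot> (- c \<odot> g)) -` interior ?U" for c
  have "open (V c)" for c
    unfolding V_def by (intro open_vimage open_interior continuous_intros)
  moreover have "c \<in> V c" for c
    using a by (simp add: V_def)
  then have "C \<subseteq> (\<Union>c\<in>C. V c)"
    by blast
  ultimately obtain C' where C': "finite C'" "C \<subseteq> (\<Union>c\<in>C'. V c)"
    using compactE_image[OF assms] by metis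
  have "\<forall>c. \<exists>M. 1 \<le> M \<and> (\<forall>p q. d ((c \<odot> - a) \<odot> p) ((c \<odot> - a) \<odot> q) \<le> M * d p q)"
    by (intro allI, rule translation_lipschitz) blast
  from choice[OF this] obtain M where
    "\<forall>c. 1 \<le> M c \<and> (\<forall>p q. d ((c \<odot> - a) \<odot> p) ((c \<odot> - a) \<odot> q) \<le> M c * d p q)" ..
  then have M: "\<And>c. 1 \<le> M c"
      "\<And>c p q. d ((c \<odot> - a) \<odot> p) ((c \<odot> - a) \<odot> q) \<le> M c * d p q"
    by blast+
  \<comment> \<open>The sum replaces a maximum over \<open>C'\<close>; the added 1 gives 1 \<le> L
    even if \<open>C'\<close> is empty.\<close>
  define L where "L = 1 + (\<Sum>c\<in>C'. M c * real n)"
  have M0: "0 \<le> M c * real n" for c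
    using M(1)[of c] by simp
  have "d (g \<odot> p) (g \<odot> q) \<le> L * d p q" if g: "g \<in> C" for g p q
  proof -
    obtain c where c: "c \<in> C'" "g \<in> V c"
      using C' g by blast
    define u where "u = a \<odot> (- c \<odot> g)"
    have "u \<in> ?U"
      using c interior_subset unfolding V_def u_def by blast
    then have "d (u \<odot> p) (u \<odot> q) \<le> real n * d p q" by simp
    moreover have cu: "(c \<odot> - a) \<odot> (u \<odot> x) = g \<odot> x" for x
      by (simp add: u_def hmult_assoc)
    ultimately have "d (g \<odot> p) (g \<odot> q) \<le> M c * (real n * d p q)"
      using M(2)[of c "u \<odot> p" "u \<odot> q"] M(1)[of c]
      unfolding cu by (elim order_trans) (intro mult_left_mono; simp)
    also have "\<dots> = M c * real n * d p q" by simp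
    also have "M c * real n \<le> (\<Sum>c\<in>C'. M c * real n)"
      using C'(1) c(1) M0 by (intro member_le_sum) auto
    then have "M c * real n * d p q \<le> L * d p q"
      by (intro mult_right_mono) (auto simp: L_def)
    finally show ?thesis .
  qed
  moreover have "1 \<le> L"
    using M0 by (simp add: L_def sum_nonneg)
  ultimately show thesis using that by blast
qed


section \<open>Economical covers of a box\<close>

lemma d_scaleR_le:
  assumes "\<And>i. i < j \<Longrightarrow> d ((real i *\<^sub>R h) \<odot> 0) ((real i *\<^sub>R h) \<odot> h) \<le> c"
  shows "d 0 (real j *\<^sub>R h) \<le> real j * c"
  using assms
proof (induction j)
  case (Suc j)
  have "d 0 (real (Suc j) *\<^sub>R h) \<le> d 0 (real j *\<^sub>R h) + d (real j *\<^sub>R h) (real (Suc j) *\<^sub>R h)"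
    by (rule triangle) auto
  also have "(real j *\<^sub>R h) \<odot> h = real (Suc j) *\<^sub>R h"
    using hmult_scaleR[of "real j" h 1] by (simp add: add.commute)
  then have "d (real j *\<^sub>R h) (real (Suc j) *\<^sub>R h) \<le> c"
    using Suc.prems[of j] by simp
  finally show ?case
    using Suc by (simp add: algebra_simps)
qed simp

text \<open>The diameter bound does not depend on \<open>m\<close>, while the number of sets gains a
  factor 1/m. Gauge 3\<rho> separates the translated boxes of size \<rho>,
  \<open>m * (3 * \<rho>) \<le> 1\<close> keeps the powers of \<open>h\<close> bounded, and the last
  hypothesis keeps them within \<rho> of 0 for \<open>d\<close>.\<close>

lemma box_cover:
  fixes m :: nat
  assumes L: "1 \<le> L" "\<And>g p q. g \<in> heis_box (R + 2) \<Longrightarrow> d (g \<odot> p) (g \<odot> q) \<le> L * d p q"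
    and R: "0 \<le> R" and m: "0 < m"
    and h: "heis_gauge h = 3 * \<rho>" "0 < \<rho>" "real m * (3 * \<rho>) \<le> 1" "real m * (L * d 0 h) \<le> \<rho>"
  obtains G F where "finite G" "heis_box R \<subseteq> (\<Union>g\<in>G. (\<odot>) g ` F)"
    "\<And>g. g \<in> G \<Longrightarrow> diam_of d ((\<odot>) g ` F) \<le> ennreal (124 * L ^ 3 * \<rho>)"
    "real m * real (card G) * \<rho> ^ 4 \<le> (R + 2) ^ 4"
proof -
  define E where "E = (\<Union>j<m. (\<odot>) (real j *\<^sub>R h) ` heis_box \<rho>)"
  \<comment> \<open>If g E meets g' E, then g lies in g' F.\<close>
  define F where "F = {x \<odot> (- y) |x y. x \<in> E \<and> y \<in> E}"
  have \<rho>1: "3 * \<rho> \<le> 1"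
  proof -
    have "1 * (3 * \<rho>) \<le> real m * (3 * \<rho>)"
      using m h by (intro mult_right_mono) auto
    then show ?thesis using h by linarith
  qed
  have hbox: "\<bar>h$1\<bar> \<le> 3 * \<rho>" "\<bar>h$2\<bar> \<le> 3 * \<rho>" "\<bar>h$3\<bar> \<le> (3 * \<rho>)\<^sup>2"
    using mem_heis_box_iff_gauge[of "3 * \<rho>" h] h by (auto simp: mem_heis_box)
  have jh: "real j *\<^sub>R h \<in> heis_box 1" if "j < m" for j
  proof -
    have j: "real j * (3 * \<rho>) \<le> 1"
    proof -
      have "real j * (3 * \<rho>) \<le> real m * (3 * \<rho>)"
        using that h by (intro mult_right_mono) auto
      then show ?thesis using h by linarith
    qed
    \<comment> \<open>Powers of \<open>h\<close> grow linearly in every coordinate, so one linear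
      bound serves the centre as well.\<close>
    have "(3 * \<rho>)\<^sup>2 \<le> 3 * \<rho>"
      using \<rho>1 h by (simp add: power2_eq_square mult_left_le_one_le)
    then have le: "\<bar>h$i\<bar> \<le> 3 * \<rho>" for i
      using exhaust_3[of i] hbox by auto
    have "\<bar>real j * h$i\<bar> \<le> 1" for i
    proof -
      have "\<bar>real j * h$i\<bar> \<le> real j * (3 * \<rho>)"
        using le[of i] by (simp only: abs_mult abs_of_nat) (intro mult_left_mono, auto)
      then show ?thesis using j by linarith
    qed
    then show ?thesis by (simp add: mem_heis_box)
  qed
  have box1: "heis_box 1 \<subseteq> heis_box (R + 2)" and box2: "heis_box 2 \<subseteq> heis_box (R + 2)"
    and boxR: "heis_box R \<subseteq> heis_box (R + 2)"
    using R by (simp_all add: heis_box_mono)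
  have E2: "E \<subseteq> heis_box 2"
  proof
    fix x assume "x \<in> E"
    then have "x \<in> heis_box (1 + \<rho>)"
      unfolding E_def by (auto intro!: heis_box_hmult jh)
    then show "x \<in> heis_box 2"
      using heis_box_mono[of "1 + \<rho>" 2] \<rho>1 h by auto
  qed
  have "0 \<in> E"
  proof -
    have "0 \<in> heis_box \<rho>" by (simp add: mem_heis_box_iff_gauge less_imp_le h)
    then have "(real 0 *\<^sub>R h) \<odot> 0 \<in> E"
      unfolding E_def using m by blast
    then show ?thesis by simp
  qed

  \<comment> \<open>A common point would make the power of \<open>h\<close> with exponent j - i a
    product of gauge at most 2\<rho>, but its gauge is at least 3\<rho>.\<close>
  have disj: "disjnt ((\<odot>) (real i *\<^sub>R h) ` heis_box \<rho>) ((\<odot>) (real j *\<^sub>R h) ` heis_box \<rho>)"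
    if "i < j" for i j
  proof (rule ccontr)
    assume "\<not> ?thesis"
    then obtain b b' where b: "b \<in> heis_box \<rho>" "b' \<in> heis_box \<rho>"
      and eq: "(real i *\<^sub>R h) \<odot> b = (real j *\<^sub>R h) \<odot> b'"
      by (auto simp: disjnt_def)
    have "b \<odot> (- b') = (- (real i *\<^sub>R h) \<odot> ((real i *\<^sub>R h) \<odot> b)) \<odot> (- b')"
      by simp
    also have "\<dots> = ((- real i) *\<^sub>R h) \<odot> (real j *\<^sub>R h)"
      unfolding eq by (simp add: hmult_assoc)
    also have "\<dots> = (real j - real i) *\<^sub>R h"
      unfolding hmult_scaleR by simp
    finally have "(real j - real i) *\<^sub>R h \<in> heis_box (\<rho> + \<rho>)"
      using heis_box_hmult[OF b(1) heis_box_minus[OF b(2)]] by simp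
    then have "heis_gauge ((real j - real i) *\<^sub>R h) \<le> 2 * \<rho>"
      using h by (simp add: mem_heis_box_iff_gauge)
    moreover have "heis_gauge h \<le> heis_gauge ((real j - real i) *\<^sub>R h)"
      using that by (intro heis_gauge_le_scaleR) linarith
    ultimately show False using h by simp
  qed
  have E_meas: "E \<in> lmeasurable"
    unfolding E_def by (intro fmeasurable.finite_UN lmeasurable_hmult) auto
  have "measure lebesgue E = (\<Sum>j<m. measure lebesgue ((\<odot>) (real j *\<^sub>R h) ` heis_box \<rho>))"
    unfolding E_def
  proof (rule measure_UNION')
    show "pairwise (\<lambda>i j. disjnt ((\<odot>) (real i *\<^sub>R h) ` heis_box \<rho>) ((\<odot>) (real j *\<^sub>R h) ` heis_box \<rho>)) {..<m}"
      unfolding pairwise_def by (metis disj disjnt_sym linorder_neqE_nat)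
  qed (auto intro!: lmeasurable_hmult)
  also have "\<dots> = real m * (8 * \<rho> ^ 4)"
    using h by (simp add: measure_hmult measure_heis_box)
  finally have E_measure: "measure lebesgue E = real m * (8 * \<rho> ^ 4)" .

  \<comment> \<open>Here 31 = 1 + 30: a walk along the powers of \<open>h\<close>, whose steps are
    translates of the pair 0, h, costs at most \<rho>; the move inside the box costs at most
    30\<rho>.\<close>
  have dE: "d 0 x \<le> 31 * \<rho>" if x: "x \<in> E" for x
  proof -
    obtain j b where jb: "j < m" "b \<in> heis_box \<rho>" "x = (real j *\<^sub>R h) \<odot> b"
      using x by (auto simp: E_def)
    have "d 0 (real j *\<^sub>R h) \<le> real j * (L * d 0 h)"
      using jh box1 jb by (intro d_scaleR_le L) auto
    also have "\<dots> \<le> real m * (L * d 0 h)"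
      using jb L by (intro mult_right_mono) auto
    finally have "d 0 (real j *\<^sub>R h) \<le> \<rho>"
      using h by simp
    moreover have "d (real j *\<^sub>R h) x \<le> 30 * \<rho>"
      using d_le_gauge[of "real j *\<^sub>R h" b] jb h by (simp add: mem_heis_box_iff_gauge)
    moreover have "d 0 x \<le> d 0 (real j *\<^sub>R h) + d (real j *\<^sub>R h) x"
      by (rule triangle) auto
    ultimately show ?thesis by simp
  qed
  \<comment> \<open>Translation by \<open>- y\<close> turns the distance from y to 0 into that from
    0 to \<open>- y\<close> at the cost of one factor L; translation by x costs a second. The
    constant is 31 + 31.\<close>
  have dF: "d 0 f \<le> 62 * L\<^sup>2 * \<rho>" if f: "f \<in> F" for f
  proof -
    obtain x y where xy: "x \<in> E" "y \<in> E" "f = x \<odot> (- y)"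
      using f by (auto simp: F_def)
    have "d (- y \<odot> y) (- y \<odot> 0) \<le> L * d y 0"
      using E2 box2 xy by (intro L heis_box_minus subsetD[OF box2]) auto
    also have "\<dots> \<le> L * (31 * \<rho>)"
      using dE[OF xy(2)] L by (simp add: commute)
    finally have y: "d 0 (- y) \<le> L * (31 * \<rho>)" by simp
    have "d (x \<odot> 0) (x \<odot> (- y)) \<le> L * d 0 (- y)"
      using E2 box2 xy by (intro L) auto
    also have "\<dots> \<le> L * (L * (31 * \<rho>))"
      using y L by (intro mult_left_mono) auto
    finally have "d x f \<le> L\<^sup>2 * (31 * \<rho>)"
      by (simp add: xy power2_eq_square)
    moreover have "d 0 x \<le> L\<^sup>2 * (31 * \<rho>)"
    proof -
      have "1 * (31 * \<rho>) \<le> L\<^sup>2 * (31 * \<rho>)"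
        using L h by (intro mult_right_mono) auto
      then show ?thesis using dE[OF xy(1)] by simp
    qed
    moreover have "d 0 f \<le> d 0 x + d x f"
      by (rule triangle) auto
    ultimately show ?thesis by simp
  qed
  \<comment> \<open>A third factor L comes from translation by g, and passing through 0 doubles
    62.\<close>
  have diam: "diam_of d ((\<odot>) g ` F) \<le> ennreal (124 * L ^ 3 * \<rho>)" if "g \<in> heis_box R" for g
  proof (rule diam_of_le)
    fix u v assume "u \<in> (\<odot>) g ` F" "v \<in> (\<odot>) g ` F"
    then obtain f f' where f: "f \<in> F" "f' \<in> F" "u = g \<odot> f" "v = g \<odot> f'"
      by blast
    have "d f f' \<le> d 0 f + d 0 f'"
      using triangle[of f 0 f'] by (simp add: commute)
    then have "d f f' \<le> 124 * L\<^sup>2 * \<rho>"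
      using dF[OF f(1)] dF[OF f(2)] by simp
    then have "L * d f f' \<le> L * (124 * L\<^sup>2 * \<rho>)"
      using L by (intro mult_left_mono) auto
    moreover have "d u v \<le> L * d f f'"
      unfolding f using that boxR by (intro L) auto
    ultimately show "d u v \<le> 124 * L ^ 3 * \<rho>"
      by (simp add: power2_eq_square power3_eq_cube algebra_simps)
  qed

  define P where "P G \<longleftrightarrow> finite G \<and> G \<subseteq> heis_box R \<and>
    pairwise (\<lambda>g g'. disjnt ((\<odot>) g ` E) ((\<odot>) g' ` E)) G" for G
  \<comment> \<open>Disjoint translates of E, each of volume 8m\<rho>^4, fit into the box of size R
    + 2.\<close>
  have card: "real m * real (card G) * \<rho> ^ 4 \<le> (R + 2) ^ 4" if "P G" for G
  proof -
    have "measure lebesgue (\<Union>g\<in>G. (\<odot>) g ` E) = (\<Sum>g\<in>G. measure lebesgue ((\<odot>) g ` E))"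
      using that E_meas by (intro measure_UNION' lmeasurable_hmult) (auto simp: P_def)
    also have "\<dots> = real (card G) * (real m * (8 * \<rho> ^ 4))"
      by (simp add: measure_hmult E_meas E_measure)
    finally have "real (card G) * (real m * (8 * \<rho> ^ 4)) = measure lebesgue (\<Union>g\<in>G. (\<odot>) g ` E)" ..
    also have "\<dots> \<le> measure lebesgue (heis_box (R + 2))"
    proof (rule measure_mono_fmeasurable)
      show "(\<Union>g\<in>G. (\<odot>) g ` E) \<subseteq> heis_box (R + 2)"
        using that E2 by (auto simp: P_def intro!: heis_box_hmult)
      show "(\<Union>g\<in>G. (\<odot>) g ` E) \<in> sets lebesgue"
        using that E_meas
        by (intro fmeasurableD fmeasurable.finite_UN lmeasurable_hmult) (auto simp: P_def)
    qed simp
    also have "\<dots> = 8 * (R + 2) ^ 4"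
      using R by (simp add: measure_heis_box)
    finally show ?thesis by (simp add: mult.commute mult.left_commute)
  qed
  \<comment> \<open>The volume bound limits the size of a packing, so one of greatest cardinality
    exists.\<close>
  obtain G where G: "P G" "\<And>G'. P G' \<Longrightarrow> card G' \<le> card G"
  proof -
    define N where "N = nat \<lceil>(R + 2) ^ 4 / (real m * \<rho> ^ 4)\<rceil> + 1"
    have "card G < N" if "P G" for G
    proof -
      have "real (card G) \<le> (R + 2) ^ 4 / (real m * \<rho> ^ 4)"
        using card[OF that] m h by (simp add: field_simps)
      then show ?thesis unfolding N_def by linarith
    qed
    moreover have "P {}" by (simp add: P_def)
    ultimately show thesis
      using ex_has_greatest_nat[of P "{}" card N] that by (metis less_imp_le)
  qed
  have "heis_box R \<subseteq> (\<Union>g\<in>G. (\<odot>) g ` F)"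
  proof
    fix g assume g: "g \<in> heis_box R"
    \<comment> \<open>For g in G take x = y = 0. Otherwise adding g would enlarge the packing, so g
      E meets some g' E.\<close>
    obtain g' x y where *: "g' \<in> G" "x \<in> E" "y \<in> E" "g \<odot> x = g' \<odot> y"
    proof (cases "g \<in> G")
      case True
      then show ?thesis using that \<open>0 \<in> E\<close> by blast
    next
      case False
      have "\<not> P (insert g G)"
        using G(2)[of "insert g G"] False G(1) by (auto simp: P_def)
      then obtain g' where "g' \<in> G" "\<not> disjnt ((\<odot>) g ` E) ((\<odot>) g' ` E)"
        using G(1) g by (auto simp: P_def pairwise_insert disjnt_sym)
      then show ?thesis using that by (auto simp: disjnt_def)
    qed
    have "g = (g \<odot> x) \<odot> (- x)" by (simp add: hmult_assoc)
    also have "\<dots> = g' \<odot> (y \<odot> (- x))"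
      unfolding *(4) by (rule hmult_assoc)
    finally show "g \<in> (\<Union>g\<in>G. (\<odot>) g ` F)"
      using * by (auto simp: F_def)
  qed
  moreover have "finite G" "G \<subseteq> heis_box R"
    using G(1) by (auto simp: P_def)
  ultimately show thesis
    using that[of G F] diam card[OF G(1)] by blast
qed

text \<open>The cover of \<open>box_cover\<close> costs at most card G * (D\<rho>)^4 \<le> D^4 (R +
  2)^4 / m. Since D depends only on the Lipschitz constant L, \<open>m\<close> can be chosen before
  \<open>h\<close>.\<close>

lemma hausdorff_measure_box_eq_0:
  assumes small: "\<And>\<epsilon> r. 0 < \<epsilon> \<Longrightarrow> 0 < r \<Longrightarrow>
      \<exists>h. 0 < heis_gauge h \<and> heis_gauge h \<le> r \<and> d 0 h \<le> \<epsilon> * heis_gauge h"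
    and R: "0 \<le> R"
  shows "hausdorff_measure 4 d (heis_box R) = 0"
  unfolding hausdorff_measure_eq_0_iff
proof (intro allI impI)
  fix \<delta> \<eta> :: real assume \<delta>: "0 < \<delta>" and \<eta>: "0 < \<eta>"
  obtain L where L: "1 \<le> L" "\<And>g p q. g \<in> heis_box (R + 2) \<Longrightarrow> d (g \<odot> p) (g \<odot> q) \<le> L * d p q"
    using uniform_translation_lipschitz[OF compact_heis_box] by blast
  define D where "D = 124 * L ^ 3"
  have D: "0 < D" using L by (simp add: D_def)
  obtain m :: nat where m: "max 1 (D ^ 4 * (R + 2) ^ 4 / \<eta>) \<le> real m"
    using real_arch_simple by blast
  then have m0: "0 < real m" by linarith
  \<comment> \<open>With gauge 3\<rho> the three bounds become m * 3\<rho> \<le> 1, D\<rho> \<le>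
    \<delta> and m L d(0, h) \<le> \<rho>.\<close>
  obtain h where h: "0 < heis_gauge h" "heis_gauge h \<le> min (1 / real m) (3 * \<delta> / D)"
      "d 0 h \<le> 1 / (3 * real m * L) * heis_gauge h"
    using small[of "1 / (3 * real m * L)" "min (1 / real m) (3 * \<delta> / D)"] m0 L D \<delta> by auto
  define \<rho> where "\<rho> = heis_gauge h / 3"
  have \<rho>: "0 < \<rho>" "real m * (3 * \<rho>) \<le> 1" "D * \<rho> \<le> \<delta>"
    using h m0 D by (auto simp: \<rho>_def field_simps)
  have mL: "real m * (L * d 0 h) \<le> \<rho>"
    using h(3) m0 L by (simp add: \<rho>_def field_simps)
  have h_\<rho>: "heis_gauge h = 3 * \<rho>" and "0 < m"
    using m0 by (simp_all add: \<rho>_def)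
  obtain G F where G: "finite G" "heis_box R \<subseteq> (\<Union>g\<in>G. (\<odot>) g ` F)"
      "\<And>g. g \<in> G \<Longrightarrow> diam_of d ((\<odot>) g ` F) \<le> ennreal (D * \<rho>)"
      "real m * real (card G) * \<rho> ^ 4 \<le> (R + 2) ^ 4"
    using box_cover[OF L R \<open>0 < m\<close> h_\<rho> \<rho>(1,2) mL] unfolding D_def by blast
  have D\<rho>: "0 \<le> D * \<rho>"
    using D \<rho>(1) by simp
  obtain E where E: "heis_box R \<subseteq> (\<Union>i. E i)" "\<And>i. diam_of d (E i) \<le> ennreal (D * \<rho>)"
      "hausdorff_cost 4 d E \<le> ennreal (real (card G) * (D * \<rho>) ^ 4)"
    using hausdorff_cost_finite_cover[OF G(1-3) D\<rho>] by blast
  have "real m * (real (card G) * (D * \<rho>) ^ 4) = D ^ 4 * (real m * real (card G) * \<rho> ^ 4)"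
    by (simp add: power_mult_distrib)
  also have "\<dots> \<le> D ^ 4 * (R + 2) ^ 4"
    using G(4) by (intro mult_left_mono) auto
  also have "\<dots> \<le> real m * \<eta>"
    using m \<eta> by (simp add: field_simps)
  finally have "real (card G) * (D * \<rho>) ^ 4 \<le> \<eta>"
    using m0 by simp
  then have "hausdorff_cost 4 d E \<le> ennreal \<eta>"
    using E(3) by (meson ennreal_leI order_trans)
  moreover have "diam_of d (E i) \<le> ennreal \<delta>" for i
    using E(2) \<rho>(3) by (meson ennreal_leI order_trans)
  ultimately show "\<exists>E. heis_box R \<subseteq> (\<Union>i. E i) \<and> (\<forall>i. diam_of d (E i) \<le> ennreal \<delta>) \<and>
      hausdorff_cost 4 d E \<le> ennreal \<eta>"
    using E(1) by blast
qed

text \<open>A pair violating equivalence with a large constant M is translated to 0 and h = p^-1 q,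
  so that M d(0, h) < 30 L times the gauge of h. Large M forces the ratio to be small, and also h
  itself, because \<open>d\<close> is bounded below away from 0 on compact sets.\<close>

lemma gauge_collapse:
  assumes K: "compact K" "\<not> bilipschitz_equivalent_on K d cc_dist"
    and \<epsilon>: "0 < \<epsilon>" and r: "0 < r"
  obtains h where "0 < heis_gauge h" "heis_gauge h \<le> r" "d 0 h \<le> \<epsilon> * heis_gauge h"
proof -
  obtain R where R: "1 \<le> R" "K \<subseteq> heis_box R"
    using bounded_imp_subset_heis_box compact_imp_bounded[OF K(1)] by blast
  obtain L where L: "1 \<le> L" "\<And>g p q. g \<in> heis_box R \<Longrightarrow> d (g \<odot> p) (g \<odot> q) \<le> L * d p q"
    using uniform_translation_lipschitz[OF compact_heis_box] by blast
  define Z where "Z = {h \<in> heis_box (R + R). r \<le> heis_gauge h}"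
  obtain \<mu> where \<mu>: "0 < \<mu>" "\<And>h. h \<in> Z \<Longrightarrow> \<mu> \<le> d 0 h"
  proof (cases "Z = {}")
    case False
    have "Z = heis_box (R + R) \<inter> {h. r \<le> heis_gauge h}"
      by (auto simp: Z_def)
    moreover have "closed {h. r \<le> heis_gauge h}"
      by (intro closed_Collect_le continuous_intros)
    ultimately have "compact Z"
      by (simp add: compact_Int_closed)
    moreover have "continuous_on Z (d 0)"
      by (intro continuous_on_d continuous_intros)
    ultimately obtain z where z: "z \<in> Z" "\<And>h. h \<in> Z \<Longrightarrow> d 0 z \<le> d 0 h"
      using continuous_attains_inf False by metis
    have "z \<noteq> 0"
      using z(1) r by (auto simp: Z_def)
    then have "0 < d 0 z"
      using zero[of 0 z] nonneg[of 0 z] by simp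
    then show ?thesis using that z by blast
  qed (use that[of 1] in auto)
  \<comment> \<open>The entry with \<epsilon> controls the ratio. The entry with \<mu> excludes
    gauge above r, since the gauge of h is at most 2R.\<close>
  define M where "M = max 1 (max (30 * L / \<epsilon>) (60 * L * R / \<mu>))"
  have M: "1 \<le> M" "30 * L / \<epsilon> \<le> M" "60 * L * R / \<mu> \<le> M"
    by (auto simp: M_def)
  obtain p q where pq: "p \<in> K" "q \<in> K" "\<not> (1 / M * cc_dist p q \<le> d p q \<and> d p q \<le> M * cc_dist p q)"
    using K(2) M(1) unfolding bilipschitz_equivalent_on_def by blast
  define h where "h = - p \<odot> q"
  \<comment> \<open>As d \<le> \<open>cc_dist\<close>, only the lower inequality can fail.\<close>
  have "d p q \<le> M * cc_dist p q"
  proof -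
    have "d p q \<le> 1 * cc_dist p q" "0 \<le> cc_dist p q"
      using d_le_cc_dist[of p q] nonneg[of p q] by linarith+
    then show ?thesis
      using mult_right_mono[OF M(1)] by (meson order_trans)
  qed
  then have "M * d p q < cc_dist p q"
    using pq M(1) by (simp add: field_simps not_le)
  also have "\<dots> \<le> 30 * heis_gauge h"
    using cc_dist_le_gauge[of p h] by (simp add: h_def)
  finally have *: "M * d p q < 30 * heis_gauge h" .
  then have gauge: "0 < heis_gauge h"
    using nonneg[of p q] M(1) by (smt (verit) mult_nonneg_nonneg)
  have "- p \<in> heis_box R"
    using pq R by (auto intro: heis_box_minus)
  then have "d 0 h \<le> L * d p q"
    using L(2)[of "- p" p q] by (simp add: h_def)
  then have "M * d 0 h \<le> L * (M * d p q)"
    using mult_left_mono[of "d 0 h" "L * d p q" M] M(1) by (simp add: mult.left_commute)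
  also have "\<dots> < L * (30 * heis_gauge h)"
    using * L by simp
  finally have **: "M * d 0 h < 30 * L * heis_gauge h" by simp
  have "30 * L * d 0 h \<le> \<epsilon> * M * d 0 h"
    using M(2) \<epsilon> by (intro mult_right_mono) (auto simp: field_simps)
  also have "\<dots> < \<epsilon> * (30 * L * heis_gauge h)"
    using ** \<epsilon> by simp
  finally have "30 * L * d 0 h < 30 * L * (\<epsilon> * heis_gauge h)"
    by (simp add: mult.commute mult.left_commute)
  then have d: "d 0 h \<le> \<epsilon> * heis_gauge h"
    using L by simp
  have "h \<in> heis_box (R + R)"
    unfolding h_def using pq R \<open>- p \<in> heis_box R\<close> by (intro heis_box_hmult) auto
  have "heis_gauge h \<le> r"
  proof (rule ccontr)
    assume "\<not> ?thesis"
    then have "\<mu> \<le> d 0 h"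
      using \<open>h \<in> heis_box (R + R)\<close> by (intro \<mu>) (auto simp: Z_def)
    have "60 * L * R \<le> M * \<mu>"
      using M(3) \<mu>(1) by (simp add: field_simps)
    also have "\<dots> \<le> M * d 0 h"
      using M \<open>\<mu> \<le> d 0 h\<close> by (intro mult_left_mono) auto
    also have "\<dots> < 30 * L * heis_gauge h" by (fact **)
    also have "\<dots> \<le> 30 * L * (R + R)"
      using \<open>h \<in> heis_box (R + R)\<close> R L
      by (intro mult_left_mono) (auto simp: mem_heis_box_iff_gauge)
    finally show False by simp
  qed
  then show thesis using that gauge d by blast
qed

end

theorem theorem1p4:
  fixes d :: "heis \<Rightarrow> heis \<Rightarrow> real"
  assumes "Metric_space UNIV d"
    and "\<And>p q. d p q \<le> cc_dist p q"
    and "hausdorff_measure 4 d (cc_ball 0 1) > 0"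
    and "\<And>g. bilipschitz_map d (\<lambda>p. g \<odot> p)"
  shows "\<forall>K. compact K \<longrightarrow> bilipschitz_equivalent_on K d cc_dist"
proof (intro allI impI, rule ccontr)
  fix K :: "heis set"
  assume K: "compact K" "\<not> bilipschitz_equivalent_on K d cc_dist"
  interpret heis_distance d
    using assms(1,2,4) by (intro heis_distance.intro heis_distance_axioms.intro)
  have "hausdorff_measure 4 d (heis_box (real n)) = 0" for n
    by (rule hausdorff_measure_box_eq_0) (use gauge_collapse[OF K] in \<open>blast, simp\<close>)
  then have "hausdorff_measure 4 d UNIV = 0"
    using hausdorff_measure_UN_null[of 4 d "\<lambda>n. heis_box (real n)"] by (simp only: Un_heis_box)
  \<comment> \<open>Every cover of the whole group also covers the ball.\<close>
  then have "hausdorff_measure 4 d (cc_ball 0 1) = 0"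
    unfolding hausdorff_measure_eq_0_iff by (meson order_trans subset_UNIV)
  then show False using assms(3) by simp
qed

end
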